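(* Let $\{e\}$ be a basis of a $1$-dimensional vector space $A$ over $\mathbb{C}$. Then, up to isomorphism, there are exactly $2$ non-isomorphic pre-Jordan algebras on $A$, namely $(A,\cdot_1)$ given by $e\cdot_1 e=e$ and $(A,\cdot_2)$ given by $e\cdot_2 e=0$. Both of them are associative.
   Context: All vector spaces and algebras are over $\mathbb{C}$. A pre-Jordan algebra is a vector space $A$ with a bilinear multiplication $\cdot:A\times A\to A$ such that, writing $x\circ y:=x\cdot y+y\cdot x$, for all $x,y,z,u\in A$: $$(x\circ y)\cdot(z\cdot u)+(y\circ z)\cdot(x\cdot u)+(z\circ x)\cdot(y\cdot u)= x\cdot(y\cdot(z\cdot u))+z\cdot(y\cdot(x\cdot u))+((x\circ z)\circ y)\cdot u= z\cdot((x\circ y)\cdot u)+x\cdot((y\circ z)\cdot u)+y\cdot((z\circ x)\cdot u).$$ An isomorphism of pre-Jordan algebras is a bijective linear map preserving the multiplications. *)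

theory Defs
  imports Complex_Main
begin

text \<open>
  The space is the whole type \<open>'a\<close>, and the scalar multiplication is an explicit parameter.
\<close>

locale complex_algebra = vector_space scale
  for scale :: "complex \<Rightarrow> 'a::ab_group_add \<Rightarrow> 'a" +
  fixes mult :: "'a \<Rightarrow> 'a \<Rightarrow> 'a"
  assumes mult_linear_left: "Vector_Spaces.linear scale scale (\<lambda>x. mult x y)"
    and mult_linear_right: "Vector_Spaces.linear scale scale (\<lambda>y. mult x y)"

definition jordan_sum :: "('a \<Rightarrow> 'a \<Rightarrow> 'a) \<Rightarrow> 'a \<Rightarrow> 'a \<Rightarrow> 'a::ab_group_add" where
  "jordan_sum mult x y = mult x y + mult y x"

locale pre_jordan_algebra = complex_algebra scale mult
  for scale :: "complex \<Rightarrow> 'a::ab_group_add \<Rightarrow> 'a" and mult (infixl "\<cdot>" 70) +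
  fixes circ (infixl "\<circ>\<^sub>J" 70)
  defines "circ \<equiv> jordan_sum mult"
  assumes pre_jordan_1:
    "(x \<circ>\<^sub>J y) \<cdot> (z \<cdot> u) + (y \<circ>\<^sub>J z) \<cdot> (x \<cdot> u) + (z \<circ>\<^sub>J x) \<cdot> (y \<cdot> u) =
     x \<cdot> (y \<cdot> (z \<cdot> u)) + z \<cdot> (y \<cdot> (x \<cdot> u)) + ((x \<circ>\<^sub>J z) \<circ>\<^sub>J y) \<cdot> u"
    and pre_jordan_2:
    "x \<cdot> (y \<cdot> (z \<cdot> u)) + z \<cdot> (y \<cdot> (x \<cdot> u)) + ((x \<circ>\<^sub>J z) \<circ>\<^sub>J y) \<cdot> u =
     z \<cdot> ((x \<circ>\<^sub>J y) \<cdot> u) + x \<cdot> ((y \<circ>\<^sub>J z) \<cdot> u) + y \<cdot> ((z \<circ>\<^sub>J x) \<cdot> u)"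

definition pre_jordan_isomorphism ::
  "(complex \<Rightarrow> 'a::ab_group_add \<Rightarrow> 'a) \<Rightarrow> ('a \<Rightarrow> 'a \<Rightarrow> 'a) \<Rightarrow>
   (complex \<Rightarrow> 'b::ab_group_add \<Rightarrow> 'b) \<Rightarrow> ('b \<Rightarrow> 'b \<Rightarrow> 'b) \<Rightarrow> ('a \<Rightarrow> 'b) \<Rightarrow> bool" where
  "pre_jordan_isomorphism scale mult scale' mult' f \<longleftrightarrow>
     pre_jordan_algebra scale mult \<and> pre_jordan_algebra scale' mult' \<and>
     Vector_Spaces.linear scale scale' f \<and> bij f \<and>
     (\<forall>x y. f (mult x y) = mult' (f x) (f y))"

definition pre_jordan_isomorphic ::
  "(complex \<Rightarrow> 'a::ab_group_add \<Rightarrow> 'a) \<Rightarrow> ('a \<Rightarrow> 'a \<Rightarrow> 'a) \<Rightarrow>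
   (complex \<Rightarrow> 'b::ab_group_add \<Rightarrow> 'b) \<Rightarrow> ('b \<Rightarrow> 'b \<Rightarrow> 'b) \<Rightarrow> bool" where
  "pre_jordan_isomorphic scale mult scale' mult' \<longleftrightarrow>
     (\<exists>f. pre_jordan_isomorphism scale mult scale' mult' f)"

end

theory Submission
  imports Defs
begin

text \<open>
  In coordinates with respect to the basis vector \<open>e\<close>, a bilinear product on a line is
  \<open>(x, y) \<mapsto> k x y\<close> for one structure constant \<open>k\<close>, determined by \<open>e \<cdot> e = k e\<close>
  (\<open>complex_algebra_iff_line_mult\<close>). Such a product is commutative and associative, and on
  it the three expressions of the pre-Jordan identities all equal \<open>6 k\<^sup>3 x y z u\<close>, because
  \<open>x \<circ> y = 2 k x y\<close>; hence every algebra on the line is pre-Jordan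
  (\<open>pre_jordan_line_mult\<close>).

  Classifying these algebras therefore means classifying the constants \<open>k\<close>. If \<open>k \<noteq> 0\<close>, the
  rescaling \<open>x \<mapsto> k x\<close> turns the constant \<open>k\<close> into \<open>1\<close>, as \<open>k (k x y) = (k x) (k y)\<close>
  (\<open>line_mult_isomorphic_one\<close>). The constants \<open>1\<close> and \<open>0\<close> remain, and they are
  inequivalent since only the second product vanishes identically
  (\<open>line_mult_one_not_isomorphic_zero\<close>).
\<close>

locale based_line = vector_space scale
  for scale :: "complex \<Rightarrow> 'a::ab_group_add \<Rightarrow> 'a" +
  fixes e :: 'a
  assumes independent_basis: "independent {e}"
    and span_basis: "span {e} = UNIV"
begin

definition coord :: "'a \<Rightarrow> complex" where
  "coord x = representation {e} x e"

lemma basis_nonzero: "e \<noteq> 0"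
  using independent_basis dependent_zero by blast

lemma coord_add [simp]: "coord (x + y) = coord x + coord y"
  using representation_add[OF independent_basis, of y x] by (simp add: coord_def span_basis)

lemma coord_scale [simp]: "coord (scale c x) = c * coord x"
  using representation_scale[OF independent_basis, of x c] by (simp add: coord_def span_basis)

lemma coord_basis [simp]: "coord e = 1"
  using representation_basis[OF independent_basis, of e] by (simp add: coord_def)

lemma scale_coord: "scale (coord x) e = x"
proof -
  obtain c where "x = scale c e"
    using span_basis by (auto simp: span_singleton)
  then show ?thesis
    by simp
qed

lemma coord_eq_iff: "x = y \<longleftrightarrow> coord x = coord y"
  by (metis scale_coord)

definition line_mult :: "complex \<Rightarrow> 'a \<Rightarrow> 'a \<Rightarrow> 'a" where
  "line_mult k x y = scale (k * coord x * coord y) e"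

lemma coord_line_mult [simp]: "coord (line_mult k x y) = k * coord x * coord y"
  by (simp add: line_mult_def)

lemma line_mult_basis: "line_mult k e e = scale k e"
  by (simp add: line_mult_def)

lemma complex_algebra_line_mult: "complex_algebra scale (line_mult k)"
  by unfold_locales (simp_all add: coord_eq_iff algebra_simps)

text \<open>
  Bilinearity gives \<open>m (x e) (y e) = x y (m e e)\<close>, so the value at the basis vector fixes the
  whole product.
\<close>

lemma complex_algebra_iff_line_mult:
  "complex_algebra scale m \<and> m e e = scale k e \<longleftrightarrow> m = line_mult k"
proof (intro iffI conjI)
  assume m: "complex_algebra scale m \<and> m e e = scale k e"
  then interpret complex_algebra scale m
    by blast
  interpret left: Vector_Spaces.linear scale scale "\<lambda>x. m x y" for y
    by (rule mult_linear_left)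
  interpret right: Vector_Spaces.linear scale scale "\<lambda>y. m x y" for x
    by (rule mult_linear_right)
  show "m = line_mult k"
  proof (intro ext)
    fix x y
    have "m x y = m (scale (coord x) e) (scale (coord y) e)"
      by (simp add: scale_coord)
    also have "\<dots> = scale (coord x) (scale (coord y) (m e e))"
      by (simp add: left.scale right.scale)
    also have "\<dots> = line_mult k x y"
      using m by (simp add: line_mult_def mult_ac)
    finally show "m x y = line_mult k x y" .
  qed
qed (simp_all add: complex_algebra_line_mult line_mult_basis)

lemma pre_jordan_line_mult: "pre_jordan_algebra scale (line_mult k)"
  by (intro pre_jordan_algebra.intro complex_algebra_line_mult pre_jordan_algebra_axioms.intro)
    (simp_all add: coord_eq_iff jordan_sum_def algebra_simps)

lemma semigroup_line_mult: "semigroup (line_mult k)"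
  by unfold_locales (simp add: coord_eq_iff)

lemma pre_jordan_algebra_iff: "pre_jordan_algebra scale m \<longleftrightarrow> (\<exists>k. m = line_mult k)"
  by (metis complex_algebra_iff_line_mult pre_jordan_algebra.axioms(1) pre_jordan_line_mult
      scale_coord)

lemma line_mult_isomorphic_one:
  assumes "k \<noteq> 0"
  shows "pre_jordan_isomorphic scale (line_mult k) scale (line_mult 1)"
proof -
  have "bij (scale k)"
    by (rule bij_betw_byWitness[where f' = "scale (inverse k)"]) (use assms in auto)
  moreover have "Vector_Spaces.linear scale scale (scale k)"
    by (rule linear_scale_self)
  moreover have "scale k (line_mult k x y) = line_mult 1 (scale k x) (scale k y)" for x y
    by (simp add: coord_eq_iff)
  ultimately show ?thesis
    unfolding pre_jordan_isomorphic_def pre_jordan_isomorphism_def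
    using pre_jordan_line_mult by blast
qed

lemma line_mult_isomorphic_refl:
  "pre_jordan_isomorphic scale (line_mult k) scale (line_mult k)"
  unfolding pre_jordan_isomorphic_def pre_jordan_isomorphism_def
  using pre_jordan_line_mult linear_id bij_id by (intro exI[of _ id]) simp

text \<open>
  A homomorphism from the product with \<open>e \<cdot> e = e\<close> to the zero product sends
  \<open>e = e \<cdot> e\<close> to \<open>0\<close>, so it is not injective.
\<close>

lemma line_mult_one_not_isomorphic_zero:
  "\<not> pre_jordan_isomorphic scale (line_mult 1) scale (line_mult 0)"
proof
  assume "pre_jordan_isomorphic scale (line_mult 1) scale (line_mult 0)"
  then obtain f where f: "Vector_Spaces.linear scale scale f" "bij f"
      "f (line_mult 1 e e) = line_mult 0 (f e) (f e)"
    unfolding pre_jordan_isomorphic_def pre_jordan_isomorphism_def by blast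
  interpret f: Vector_Spaces.linear scale scale f
    by (fact f(1))
  have "f e = f 0"
    using f(3) by (simp add: line_mult_def f.zero)
  then show False
    using f(2) basis_nonzero by (metis bij_is_inj injD)
qed

end

theorem proposition3p1:
  fixes scale :: "complex \<Rightarrow> 'a::ab_group_add \<Rightarrow> 'a" and e :: 'a
  assumes "vector_space scale"
    and "module.independent scale {e}"
    and "module.span scale {e} = UNIV"
  shows
    "\<exists>mult\<^sub>1 mult\<^sub>2.
       (\<forall>m. complex_algebra scale m \<and> m e e = e \<longleftrightarrow> m = mult\<^sub>1) \<and>
       (\<forall>m. complex_algebra scale m \<and> m e e = 0 \<longleftrightarrow> m = mult\<^sub>2) \<and>
       pre_jordan_algebra scale mult\<^sub>1 \<and>
       pre_jordan_algebra scale mult\<^sub>2 \<and>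
       \<not> pre_jordan_isomorphic scale mult\<^sub>1 scale mult\<^sub>2 \<and>
       (\<forall>m. pre_jordan_algebra scale m \<longrightarrow>
          pre_jordan_isomorphic scale m scale mult\<^sub>1 \<or>
          pre_jordan_isomorphic scale m scale mult\<^sub>2) \<and>
       semigroup mult\<^sub>1 \<and> semigroup mult\<^sub>2"
proof -
  interpret based_line scale e
    using assms by (simp add: based_line_def based_line_axioms_def module_iff_vector_space)
  have one: "complex_algebra scale m \<and> m e e = e \<longleftrightarrow> m = line_mult 1" for m
    using complex_algebra_iff_line_mult[of m 1] by simp
  have zero: "complex_algebra scale m \<and> m e e = 0 \<longleftrightarrow> m = line_mult 0" for m
    using complex_algebra_iff_line_mult[of m 0] by simp
  have classification: "pre_jordan_isomorphic scale m scale (line_mult 1) \<or>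
      pre_jordan_isomorphic scale m scale (line_mult 0)" if "pre_jordan_algebra scale m" for m
    using that line_mult_isomorphic_one line_mult_isomorphic_refl
    by (metis pre_jordan_algebra_iff)
  show ?thesis
    using one zero classification pre_jordan_line_mult semigroup_line_mult
      line_mult_one_not_isomorphic_zero
    by (intro exI[of _ "line_mult 1"] exI[of _ "line_mult 0"] conjI allI impI)
qed

end
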